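(* Let $\mathbb{R}^d$ be the parameter space, of given dimension $d\ge 1$. Consider the family of multi-distribution learning problems with per-distribution losses $$\mathcal{L}_e(\theta)=\tfrac12\theta^TA\theta+b_e^T\theta,\qquad \mathbb{E}_e[b_e]=0,$$ parameterized by a symmetric positive definite matrix $A\in\mathbb{R}^{d\times d}$ and a collection of linear coefficients $\{b_e\}\subset\mathbb{R}^d$ satisfying $\mathbb{E}_e[b_e]=0$. Let $R(\theta)=\mathbb{E}_e[\mathcal{L}_e(\theta)]$, $\theta^\star=\arg\min_\theta R(\theta)$, $\bar H=\mathbb{E}_e[\nabla^2\mathcal{L}_e(\theta^\star)]$ and $\Sigma_g=\mathrm{Cov}_e(\nabla\mathcal{L}_e(\theta^\star))$. For every $M>0$, there exist instances of this family such that: (i) (flat but misaligned) $\mathrm{tr}(\bar H)\le M^{-1}$ and $\mathrm{tr}(\bar H^{-1}\Sigma_g)\ge M$; (ii) (aligned but sharp) $\mathrm{tr}(\bar H^{-1}\Sigma_g)\le M^{-1}$ and $\mathrm{tr}(\bar H)\ge M$ (one instance for (i) and another for (ii)). In particular, neither $\mathrm{tr}(\bar H)$ nor $\mathrm{tr}(\bar H^{-1}\Sigma_g)$ can be bounded above by any function of the other alone: there is no real-valued function $\phi$ such that $\mathrm{tr}(\bar H^{-1}\Sigma_g)\le\phi(\mathrm{tr}(\bar H))$ for all instances of the family, and no real-valued function $\psi$ such that $\mathrm{tr}(\bar H)\le\psi(\mathrm{tr}(\bar H^{-1}\Sigma_g))$ for all instances of the family.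
   Context: The dimension $d$ is that of the ambient parameter space and is not part of the choice of instance. An instance of the family consists of a symmetric positive definite matrix $A\in\mathbb{R}^{d\times d}$ and a probability distribution $\mathcal{P}$ over environments $e$ together with vectors $b_e\in\mathbb{R}^d$ having finite second moments and mean zero under $\mathcal{P}$. $\mathbb{E}_e$ and $\mathrm{Cov}_e$ denote expectation and covariance over $e\sim\mathcal{P}$; for a random vector $g_e$ with mean $\bar g$, $\mathrm{Cov}_e(g_e)=\mathbb{E}_e[(g_e-\bar g)(g_e-\bar g)^T]$. *)

theory Defs
  imports "HOL-Probability.Probability"
begin

definition gradient :: "(real^'d \<Rightarrow> real) \<Rightarrow> real^'d \<Rightarrow> real^'d" where
  "gradient f x = (THE D. GDERIV f x :> D)"

definition hessian :: "(real^'d \<Rightarrow> real) \<Rightarrow> real^'d \<Rightarrow> real^'d^'d" where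
  "hessian f x = jacobian (gradient f) (at x)"

definition outer_product :: "real^'d \<Rightarrow> real^'d \<Rightarrow> real^'d^'d" where
  "outer_product v w = (\<chi> i j. v $ i * w $ j)"

definition covariance_matrix :: "'e measure \<Rightarrow> ('e \<Rightarrow> real^'d) \<Rightarrow> real^'d^'d" where
  "covariance_matrix P g =
     (let m = (\<integral>e. g e \<partial>P) in \<integral>e. outer_product (g e - m) (g e - m) \<partial>P)"

definition symmetric_positive_definite :: "real^'d^'d \<Rightarrow> bool" where
  "symmetric_positive_definite A \<longleftrightarrow>
     transpose A = A \<and> (\<forall>x. x \<noteq> 0 \<longrightarrow> x \<bullet> (A *v x) > 0)"

text \<open>Below, \<open>L e\<close> is the loss of environment \<open>e\<close> and \<open>P\<close> is the
  distribution of the environments.\<close>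

definition risk :: "'e measure \<Rightarrow> ('e \<Rightarrow> real^'d \<Rightarrow> real) \<Rightarrow> real^'d \<Rightarrow> real" where
  "risk P L \<theta> = (\<integral>e. L e \<theta> \<partial>P)"

text \<open>\<open>arg_min\<close> chooses some minimizer; for the quadratic instances below the minimizer exists and
  is unique, because \<open>A\<close> is positive definite.\<close>

definition risk_minimizer :: "'e measure \<Rightarrow> ('e \<Rightarrow> real^'d \<Rightarrow> real) \<Rightarrow> real^'d" where
  "risk_minimizer P L = arg_min (risk P L) (\<lambda>_. True)"

definition mean_hessian :: "'e measure \<Rightarrow> ('e \<Rightarrow> real^'d \<Rightarrow> real) \<Rightarrow> real^'d^'d" where
  "mean_hessian P L = (\<integral>e. hessian (L e) (risk_minimizer P L) \<partial>P)"

definition gradient_covariance :: "'e measure \<Rightarrow> ('e \<Rightarrow> real^'d \<Rightarrow> real) \<Rightarrow> real^'d^'d" where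
  "gradient_covariance P L = covariance_matrix P (\<lambda>e. gradient (L e) (risk_minimizer P L))"

definition sharpness :: "'e measure \<Rightarrow> ('e \<Rightarrow> real^'d \<Rightarrow> real) \<Rightarrow> real" where
  "sharpness P L = trace (mean_hessian P L)"

definition misalignment :: "'e measure \<Rightarrow> ('e \<Rightarrow> real^'d \<Rightarrow> real) \<Rightarrow> real" where
  "misalignment P L = trace (matrix_inv (mean_hessian P L) ** gradient_covariance P L)"

definition quadratic_loss :: "real^'d^'d \<Rightarrow> ('e \<Rightarrow> real^'d) \<Rightarrow> 'e \<Rightarrow> real^'d \<Rightarrow> real" where
  "quadratic_loss A b e \<theta> = 1/2 * (\<theta> \<bullet> (A *v \<theta>)) + b e \<bullet> \<theta>"

definition quadratic_instance ::
  "'e measure \<Rightarrow> real^'d^'d \<Rightarrow> ('e \<Rightarrow> real^'d) \<Rightarrow> bool" where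
  "quadratic_instance P A b \<longleftrightarrow>
     prob_space P \<and> symmetric_positive_definite A \<and>
     b \<in> borel_measurable P \<and> integrable P (\<lambda>e. (norm (b e))\<^sup>2) \<and> (\<integral>e. b e \<partial>P) = 0"

end

theory Submission
  imports Defs
begin

(* The Hessian of every loss is A, and the gradients at any fixed point have covariance E[b b^T],
   so the position of the minimizer plays no role. For A = a I and b a fair random sign times a fixed
   vector v, the two traces are d a and |v|^2 / a: they take any two prescribed positive values. *)

text \<open>\<open>gradient\<close> is a definite description, so it can be evaluated only once the
  derivative is known to be unique. The functional \<open>h \<bullet> D\<close> determines the
  vector \<open>D\<close>.\<close>

lemma gradient_eq:
  assumes "GDERIV f x :> D"
  shows "gradient f x = D"
  unfolding gradient_def
proof (rule the_equality)
  fix D' assume "GDERIV f x :> D'"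
  then have "(\<lambda>h. h \<bullet> D') = (\<lambda>h. h \<bullet> D)"
    using assms has_derivative_unique unfolding gderiv_def by blast
  then show "D' = D"
    unfolding fun_eq_iff vector_eq_ldot .
qed (fact assms)

lemma gradient_quadratic_loss:
  fixes A :: "real^'d^'d"
  assumes "transpose A = A"
  shows "gradient (quadratic_loss A b e) = (\<lambda>\<theta>. A *v \<theta> + b e)"
proof (rule ext, rule gradient_eq)
  fix \<theta> :: "real^'d"
  have A: "((*v) A has_derivative (*v) A) (at \<theta>)"
    by (rule bounded_linear_imp_has_derivative) (rule matrix_vector_mul_bounded_linear)
  \<comment> \<open>The product rule gives two terms, one from each occurrence of \<theta> in the
    quadratic form. Symmetry of \<open>A\<close> makes them equal, which cancels the factor
    1/2.\<close>
  have symm: "\<theta> \<bullet> (A *v h) = h \<bullet> (A *v \<theta>)" for h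
    by (metis assms dot_lmul_matrix inner_commute transpose_matrix_vector)
  show "GDERIV (quadratic_loss A b e) \<theta> :> A *v \<theta> + b e"
    unfolding gderiv_def quadratic_loss_def
    by (rule derivative_eq_intros A refl)+ (simp add: fun_eq_iff symm inner_add_right inner_commute)
qed

lemma hessian_quadratic_loss:
  fixes A :: "real^'d^'d"
  assumes "transpose A = A"
  shows "hessian (quadratic_loss A b e) \<theta> = A"
proof -
  have "((\<lambda>\<theta>. A *v \<theta> + b e) has_derivative (*v) A) (at \<theta>)"
    by (auto intro!: derivative_eq_intros bounded_linear_imp_has_derivative)
  then have "frechet_derivative (\<lambda>\<theta>. A *v \<theta> + b e) (at \<theta>) = (*v) A"
    using frechet_derivative_at by metis
  then show ?thesis
    by (simp add: hessian_def jacobian_def gradient_quadratic_loss[OF assms])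
qed

lemma mean_hessian_quadratic_loss:
  assumes "quadratic_instance P A b"
  shows "mean_hessian P (quadratic_loss A b) = A"
proof -
  interpret prob_space P
    using assms by (simp add: quadratic_instance_def)
  from assms show ?thesis
    by (simp add: quadratic_instance_def symmetric_positive_definite_def mean_hessian_def
        hessian_quadratic_loss prob_space)
qed

lemma gradient_covariance_quadratic_loss:
  assumes "quadratic_instance P A b"
  shows "gradient_covariance P (quadratic_loss A b) = (\<integral>e. outer_product (b e) (b e) \<partial>P)"
proof -
  interpret prob_space P
    using assms by (simp add: quadratic_instance_def)
  \<comment> \<open>The mean of the gradient \<open>A *v \<theta> + b e\<close> splits only if
    \<open>b\<close> is integrable. This follows from the second moment, since t \<le> 1 + t^2. As
    \<open>b\<close> has mean zero, centering then removes \<open>A *v \<theta>\<close> and leaves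
    \<open>b e\<close>, wherever the minimizer lies.\<close>
  have "integrable P (\<lambda>e. 1 + (norm (b e))\<^sup>2)"
    using assms by (simp add: quadratic_instance_def)
  then have "integrable P b"
  proof (rule Bochner_Integration.integrable_bound)
    show "AE e in P. norm (b e) \<le> norm (1 + (norm (b e))\<^sup>2)"
    proof (rule AE_I2)
      fix e
      have "0 \<le> (norm (b e) - 1)\<^sup>2"
        by simp
      then show "norm (b e) \<le> norm (1 + (norm (b e))\<^sup>2)"
        using norm_ge_zero[of "b e"] unfolding power2_diff real_norm_def abs_if
        by (smt (verit) power_one)
    qed
  qed (use assms in \<open>simp add: quadratic_instance_def\<close>)
  with assms show ?thesis
    by (simp add: quadratic_instance_def symmetric_positive_definite_def gradient_covariance_def
        covariance_matrix_def gradient_quadratic_loss prob_space)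
qed

lemma trace_outer_product: "trace (outer_product v w) = v \<bullet> w"
  by (simp add: trace_def outer_product_def inner_vec_def)

text \<open>\<open>matrix_inv\<close> is a choice among two-sided inverses, and C = C(AB) = (CA)B =
  B leaves only one candidate.\<close>

lemma matrix_inv_unique:
  fixes A :: "'a::semiring_1^'n^'m"
  assumes "A ** B = mat 1" "B ** A = mat 1"
  shows "matrix_inv A = B"
  unfolding matrix_inv_def
proof (rule some_equality)
  fix C assume "A ** C = mat 1 \<and> C ** A = mat 1"
  with assms(1) show "C = B"
    by (metis matrix_mul_assoc matrix_mul_lid matrix_mul_rid)
qed (use assms in simp)

lemma matrix_inv_scaleR_mat_1:
  fixes a :: real
  assumes "a \<noteq> 0"
  shows "matrix_inv (a *\<^sub>R mat 1 :: real^'d^'d) = inverse a *\<^sub>R mat 1"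
  by (rule matrix_inv_unique) (simp_all add: assms matrix_scalar_ac scalar_matrix_assoc[symmetric])

text \<open>The integral is pulled back to the two signs instead of being summed over the values
  \<open>v\<close> and \<open>- v\<close>, so the formula also covers \<open>v = 0\<close>, where
  these values coincide.\<close>

lemma integral_fair_sign:
  fixes f :: "'a::real_vector \<Rightarrow> 'b::{banach,second_countable_topology}"
  shows "(\<integral>e. f e \<partial>map_pmf (\<lambda>s. if s then v else - v) (bernoulli_pmf (1/2)))
    = (1/2) *\<^sub>R f v + (1/2) *\<^sub>R f (- v)"
  by (simp add: integral_measure_pmf[of UNIV] UNIV_bool)

lemma quadratic_instance_exists:
  fixes s m :: real
  assumes "s > 0" "m \<ge> 0"
  obtains P :: "(real^'d) measure" and A :: "real^'d^'d" and b where
    "quadratic_instance P A b"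
    "sharpness P (quadratic_loss A b) = s"
    "misalignment P (quadratic_loss A b) = m"
proof -
  \<comment> \<open>The constants solve d a = s and |v|^2 / a = m. Any coordinate may carry
    \<open>v\<close>, hence the index \<open>undefined\<close>. An environment is its own linear
    coefficient, so \<open>b\<close> is \<open>id\<close>.\<close>
  define a where "a = s / CARD('d)"
  define A :: "real^'d^'d" where "A = a *\<^sub>R mat 1"
  define v :: "real^'d" where "v = axis undefined (sqrt (a * m))"
  define P where "P = measure_pmf (map_pmf (\<lambda>s. if s then v else - v) (bernoulli_pmf (1/2)))"
  have "a > 0"
    using assms by (simp add: a_def)
  have A_mult: "A *v x = a *\<^sub>R x" for x
    by (simp add: A_def scaleR_matrix_vector_assoc[symmetric])
  have "symmetric_positive_definite A"
    using \<open>a > 0\<close> unfolding symmetric_positive_definite_def A_mult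
    by (simp add: A_def transpose_scalar)
  moreover have "integrable P (\<lambda>e. (norm (id e))\<^sup>2)"
    unfolding P_def by (rule integrable_measure_pmf_finite) simp
  moreover have "(\<integral>e. id e \<partial>P) = 0"
    by (simp only: P_def integral_fair_sign) simp
  ultimately have inst: "quadratic_instance P A id"
    by (simp add: quadratic_instance_def P_def measure_pmf.prob_space_axioms)
  note mean_hessian = mean_hessian_quadratic_loss[OF inst]
  have sharp: "sharpness P (quadratic_loss A id) = s"
    by (simp add: sharpness_def mean_hessian) (simp add: A_def a_def trace_def mat_def)
  \<comment> \<open>Both outcomes have the same outer product, as the sign enters twice.\<close>
  have "gradient_covariance P (quadratic_loss A id) = outer_product v v"
    unfolding gradient_covariance_quadratic_loss[OF inst]
    by (simp only: P_def integral_fair_sign) (simp add: outer_product_def vec_eq_iff)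
  then have "misalignment P (quadratic_loss A id) = trace (inverse a *\<^sub>R outer_product v v)"
    using \<open>a > 0\<close>
    by (simp add: misalignment_def mean_hessian)
      (simp add: A_def matrix_inv_scaleR_mat_1 flip: scalar_matrix_assoc)
  also have "\<dots> = inverse a * trace (outer_product v v)"
    by (simp add: trace_def sum_distrib_left)
  also have "\<dots> = m"
    using \<open>a > 0\<close> assms by (simp add: trace_outer_product v_def inner_axis_axis)
  finally show thesis
    using inst sharp that by blast
qed

(* HOL cannot quantify over the type of environments inside a formula, so environments are taken in
   real^'d. No instance is lost: for an instance (P, A, b) over any other type of environments,
   (distr P borel b, A, id) has the same law of b, hence the same risk, Hessian and covariance.
   Neither P nor b is restricted otherwise. *)
theorem mainTheorem2:
  shows
    "(\<forall>M>0.
        (\<exists>(P :: (real^'d) measure) (A :: real^'d^'d) b.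
           quadratic_instance P A b \<and>
           sharpness P (quadratic_loss A b) \<le> inverse M \<and>
           misalignment P (quadratic_loss A b) \<ge> M) \<and>
        (\<exists>(P :: (real^'d) measure) (A :: real^'d^'d) b.
           quadratic_instance P A b \<and>
           misalignment P (quadratic_loss A b) \<le> inverse M \<and>
           sharpness P (quadratic_loss A b) \<ge> M)) \<and>
     (\<nexists>\<phi> :: real \<Rightarrow> real.
        \<forall>(P :: (real^'d) measure) (A :: real^'d^'d) b. quadratic_instance P A b \<longrightarrow>
          misalignment P (quadratic_loss A b) \<le> \<phi> (sharpness P (quadratic_loss A b))) \<and>
     (\<nexists>\<psi> :: real \<Rightarrow> real.
        \<forall>(P :: (real^'d) measure) (A :: real^'d^'d) b. quadratic_instance P A b \<longrightarrow>
          sharpness P (quadratic_loss A b) \<le> \<psi> (misalignment P (quadratic_loss A b)))"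
proof (intro conjI allI impI notI)
  fix M :: real assume "M > 0"
  obtain P :: "(real^'d) measure" and A :: "real^'d^'d" and b where "quadratic_instance P A b"
    "sharpness P (quadratic_loss A b) = inverse M" "misalignment P (quadratic_loss A b) = M"
    by (rule quadratic_instance_exists[of "inverse M" "M"]) (use \<open>M > 0\<close> in auto)
  then show "\<exists>(P :: (real^'d) measure) (A :: real^'d^'d) b. quadratic_instance P A b \<and>
      sharpness P (quadratic_loss A b) \<le> inverse M \<and> misalignment P (quadratic_loss A b) \<ge> M"
    by (intro exI[of _ P] exI[of _ A] exI[of _ b]) simp
next
  fix M :: real assume "M > 0"
  obtain P :: "(real^'d) measure" and A :: "real^'d^'d" and b where "quadratic_instance P A b"
    "sharpness P (quadratic_loss A b) = M" "misalignment P (quadratic_loss A b) = inverse M"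
    by (rule quadratic_instance_exists[of "M" "inverse M"]) (use \<open>M > 0\<close> in auto)
  then show "\<exists>(P :: (real^'d) measure) (A :: real^'d^'d) b. quadratic_instance P A b \<and>
      misalignment P (quadratic_loss A b) \<le> inverse M \<and> sharpness P (quadratic_loss A b) \<ge> M"
    by (intro exI[of _ P] exI[of _ A] exI[of _ b]) simp
next
  assume "\<exists>\<phi> :: real \<Rightarrow> real. \<forall>(P :: (real^'d) measure) (A :: real^'d^'d) b. quadratic_instance P A b \<longrightarrow>
    misalignment P (quadratic_loss A b) \<le> \<phi> (sharpness P (quadratic_loss A b))"
  then obtain \<phi> :: "real \<Rightarrow> real" where
    \<phi>: "\<And>(P :: (real^'d) measure) (A :: real^'d^'d) b. quadratic_instance P A b \<Longrightarrow>
      misalignment P (quadratic_loss A b) \<le> \<phi> (sharpness P (quadratic_loss A b))"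
    by blast
  \<comment> \<open>With the sharpness fixed at 1, the bound is the single number
    \<open>\<phi> 1\<close>, which the misalignment is made to exceed. The absolute value keeps the
    prescribed misalignment nonnegative.\<close>
  obtain P :: "(real^'d) measure" and A :: "real^'d^'d" and b where "quadratic_instance P A b"
    "sharpness P (quadratic_loss A b) = 1" "misalignment P (quadratic_loss A b) = \<bar>\<phi> 1\<bar> + 1"
    by (rule quadratic_instance_exists[of 1 "\<bar>\<phi> 1\<bar> + 1"]) auto
  with \<phi>[of P A b] show False
    by simp
next
  assume "\<exists>\<psi> :: real \<Rightarrow> real. \<forall>(P :: (real^'d) measure) (A :: real^'d^'d) b. quadratic_instance P A b \<longrightarrow>
    sharpness P (quadratic_loss A b) \<le> \<psi> (misalignment P (quadratic_loss A b))"
  then obtain \<psi> :: "real \<Rightarrow> real" where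
    \<psi>: "\<And>(P :: (real^'d) measure) (A :: real^'d^'d) b. quadratic_instance P A b \<Longrightarrow>
      sharpness P (quadratic_loss A b) \<le> \<psi> (misalignment P (quadratic_loss A b))"
    by blast
  \<comment> \<open>The same argument with the two traces exchanged; here the absolute value keeps
    the prescribed sharpness positive.\<close>
  obtain P :: "(real^'d) measure" and A :: "real^'d^'d" and b where "quadratic_instance P A b"
    "sharpness P (quadratic_loss A b) = \<bar>\<psi> 1\<bar> + 1" "misalignment P (quadratic_loss A b) = 1"
    by (rule quadratic_instance_exists[of "\<bar>\<psi> 1\<bar> + 1" 1]) auto
  with \<psi>[of P A b] show False
    by simp
qed

end
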